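(* Let $\mathcal{H}$ be a real Hilbert space, let $S\subseteq\mathcal{H}$ be nonempty, and let $\alpha:S\to\mathbb{R}$, $v:S\to\mathcal{H}$ satisfy $$K_1:=\sup_{s_1,s_2\in S,\ s_1\neq s_2}\frac{|\alpha(s_{2})-\alpha(s_{1})-\langle v(s_{1}),s_{2}-s_{1}\rangle|}{|s_{1}-s_{2}|^{2}}<+\infty,\qquad K_2:=\sup_{s_1,s_2\in S,\ s_1\neq s_2}\frac{|v(s_{1})-v(s_{2})|}{|s_{1}-s_{2}|}<+\infty .$$ Set $$\overline{\mu}:=2K_1+K_2+\sqrt{(2K_1+K_2)^2+K_2^2},$$ and, for $s\in S$, $$\tilde{\alpha}(s):=\alpha(s)+\tfrac12\overline{\mu}|s|^{2},\qquad \tilde v(s):=v(s)+\overline{\mu}s .$$ Let $F$ be the convex extension of $(\tilde\alpha,\tilde v)$ given, for $x\in\mathcal{H}$, by $$F(x)=\lim_{\varepsilon\nearrow\frac{1}{2\overline{\mu}}}\ \inf_{z\in\mathcal{H}}\ \sup_{y\in\mathcal{H}}\Big\{\tilde f(y)-\frac{|y-z|^{2}}{2\varepsilon}+\frac{|z-x|^{2}}{2\varepsilon}\Big\},\qquad \tilde f(y):=\sup_{s\in S}\{\tilde\alpha(s)+\langle\tilde v(s),y-s\rangle\}.$$ Then the function $$G(x)=F(x)-\tfrac12\overline{\mu}|x|^2,\qquad x\in\mathcal{H},$$ is a $C^{1,1}$ extension of $(\alpha,v)$; that is, $G:\mathcal{H}\to\mathbb{R}$ is differentiable with Lipschitz continuous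 gradient, and $G(s)=\alpha(s)$, $\nabla G(s)=v(s)$ for all $s\in S$. Moreover, $G$ is almost minimal, i.e. $$\Gamma^{1}(S,(\alpha,v))\leq\Gamma^{1}(\mathcal{H},(G,\nabla G))=\mathrm{Lip}(\nabla G)\leq\left(\frac{5+\sqrt{29}}{2}\right)\Gamma^{1}(S,(\alpha,v)).$$
   Context: $\langle\cdot,\cdot\rangle$ and $|\cdot|$ denote the inner product and norm of $\mathcal{H}$ (and $|\cdot|$ also the absolute value on $\mathbb{R}$). For a nonempty set $T\subseteq\mathcal{H}$ and functions $a:T\to\mathbb{R}$, $w:T\to\mathcal{H}$, define $$\Gamma^{1}(T,(a,w)):=\sup_{s_1,s_2\in T,\ s_1\neq s_2}\left(\sqrt{A_{s_1s_2}^2+|B_{s_1s_2}|^2}+|A_{s_1s_2}|\right),$$ where $$A_{s_1s_2}=\frac{2(a(s_1)-a(s_2))+\langle w(s_1)+w(s_2),s_2-s_1\rangle}{|s_1-s_2|^2},\qquad B_{s_1s_2}=\frac{w(s_1)-w(s_2)}{|s_1-s_2|}.$$ $\mathrm{Lip}(\nabla G)$ denotes the best Lipschitz constant of $\nabla G:\mathcal{H}\to\mathcal{H}$. The notation $\varepsilon\nearrow c$ means $\varepsilon\to c$ with $0<\varepsilon<c$; if $\overline\mu=0$, $\frac{1}{2\overline\mu}$ is understood as $+\infty$. Suprema over an empty set of pairs (when the set has only one point) are understood to be $0$. *)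

theory Defs
  imports "HOL-Analysis.Analysis"
begin

text \<open>A Hilbert space is a type of sort \<open>{real_inner, complete_space}\<close>. A jet on a set \<open>T\<close>
  is a pair of total functions \<open>a\<close>, \<open>w\<close>, of which only the values on \<open>T\<close> matter.\<close>

definition distinct_pairs :: "'a set \<Rightarrow> ('a \<times> 'a) set" where
  "distinct_pairs T = {(s, t). s \<in> T \<and> t \<in> T \<and> s \<noteq> t}"

text \<open>The suprema below are taken in \<^typ>\<open>ennreal\<close>: they may be infinite, and the supremum of the
  empty family is \<open>0\<close>. All the quantities under \<^const>\<open>ennreal\<close> are nonnegative, so nothing is
  truncated.\<close>

definition K1 :: "'a::real_inner set \<Rightarrow> ('a \<Rightarrow> real) \<Rightarrow> ('a \<Rightarrow> 'a) \<Rightarrow> ennreal" where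
  "K1 S a w = (SUP (s, t) \<in> distinct_pairs S.
     ennreal (\<bar>a t - a s - inner (w s) (t - s)\<bar> / (norm (s - t))\<^sup>2))"

definition K2 :: "'a::real_inner set \<Rightarrow> ('a \<Rightarrow> 'a) \<Rightarrow> ennreal" where
  "K2 S w = (SUP (s, t) \<in> distinct_pairs S. ennreal (norm (w s - w t) / norm (s - t)))"

definition coefA :: "('a::real_inner \<Rightarrow> real) \<Rightarrow> ('a \<Rightarrow> 'a) \<Rightarrow> 'a \<Rightarrow> 'a \<Rightarrow> real" where
  "coefA a w s t = (2 * (a s - a t) + inner (w s + w t) (t - s)) / (norm (s - t))\<^sup>2"

definition coefB :: "('a::real_inner \<Rightarrow> 'a) \<Rightarrow> 'a \<Rightarrow> 'a \<Rightarrow> 'a" where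
  "coefB w s t = (w s - w t) /\<^sub>R norm (s - t)"

definition Gamma1 :: "'a::real_inner set \<Rightarrow> ('a \<Rightarrow> real) \<Rightarrow> ('a \<Rightarrow> 'a) \<Rightarrow> ennreal" where
  "Gamma1 T a w = (SUP (s, t) \<in> distinct_pairs T.
     ennreal (sqrt ((coefA a w s t)\<^sup>2 + (norm (coefB w s t))\<^sup>2) + \<bar>coefA a w s t\<bar>))"

definition grad :: "('a::real_inner \<Rightarrow> real) \<Rightarrow> 'a \<Rightarrow> 'a" where
  "grad g x = (THE D. GDERIV g x :> D)"

text \<open>The best Lipschitz constant of a map on the whole space; it is \<open>\<infinity>\<close> (the infimum of the empty
  set) if the map is not Lipschitz.\<close>

definition Lip :: "('a::metric_space \<Rightarrow> 'b::metric_space) \<Rightarrow> ennreal" where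
  "Lip h = (INF L \<in> {L. L-lipschitz_on UNIV h}. ennreal L)"

definition C11_extension ::
  "'a::real_inner set \<Rightarrow> ('a \<Rightarrow> real) \<Rightarrow> ('a \<Rightarrow> 'a) \<Rightarrow> ('a \<Rightarrow> real) \<Rightarrow> bool" where
  "C11_extension S a w g \<longleftrightarrow>
     (\<forall>x. GDERIV g x :> grad g x) \<and>
     (\<exists>L. L-lipschitz_on UNIV (grad g)) \<and>
     (\<forall>s\<in>S. g s = a s \<and> grad g s = w s)"

text \<open>The number \<open>\<mu>\<close> below is meaningful only if \<^const>\<open>K1\<close> and \<^const>\<open>K2\<close> are finite, since
  \<^const>\<open>enn2real\<close> maps \<open>\<infinity>\<close> to \<open>0\<close>.\<close>

definition mu_bar :: "'a::real_inner set \<Rightarrow> ('a \<Rightarrow> real) \<Rightarrow> ('a \<Rightarrow> 'a) \<Rightarrow> real" where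
  "mu_bar S \<alpha> v = (let k1 = enn2real (K1 S \<alpha> v); k2 = enn2real (K2 S v) in
     2 * k1 + k2 + sqrt ((2 * k1 + k2)\<^sup>2 + k2\<^sup>2))"

definition alpha_tilde ::
  "'a::real_inner set \<Rightarrow> ('a \<Rightarrow> real) \<Rightarrow> ('a \<Rightarrow> 'a) \<Rightarrow> 'a \<Rightarrow> real" where
  "alpha_tilde S \<alpha> v s = \<alpha> s + 1/2 * mu_bar S \<alpha> v * (norm s)\<^sup>2"

definition v_tilde ::
  "'a::real_inner set \<Rightarrow> ('a \<Rightarrow> real) \<Rightarrow> ('a \<Rightarrow> 'a) \<Rightarrow> 'a \<Rightarrow> 'a" where
  "v_tilde S \<alpha> v s = v s + mu_bar S \<alpha> v *\<^sub>R s"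

definition f_tilde ::
  "'a::real_inner set \<Rightarrow> ('a \<Rightarrow> real) \<Rightarrow> ('a \<Rightarrow> 'a) \<Rightarrow> 'a \<Rightarrow> ereal" where
  "f_tilde S \<alpha> v y =
     (SUP s\<in>S. ereal (alpha_tilde S \<alpha> v s + inner (v_tilde S \<alpha> v s) (y - s)))"

definition F_eps ::
  "'a::real_inner set \<Rightarrow> ('a \<Rightarrow> real) \<Rightarrow> ('a \<Rightarrow> 'a) \<Rightarrow> real \<Rightarrow> 'a \<Rightarrow> ereal" where
  "F_eps S \<alpha> v \<epsilon> x =
     (INF z. SUP y. f_tilde S \<alpha> v y - ereal ((norm (y - z))\<^sup>2 / (2 * \<epsilon>))
                                    + ereal ((norm (z - x))\<^sup>2 / (2 * \<epsilon>)))"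

text \<open>The filter of the limit \<open>\<epsilon> \<rightarrow> 1/(2\<mu>)\<close> from below. For \<open>\<mu> > 0\<close> the restriction \<open>\<epsilon> > 0\<close> holds
  eventually along \<^const>\<open>at_left\<close>, so it need not be imposed; for \<open>\<mu> = 0\<close> the limit point is \<open>+\<infinity>\<close>
  (and \<open>1 / 0 = 0\<close> in HOL, which would be the wrong value).\<close>

definition eps_filter :: "real \<Rightarrow> real filter" where
  "eps_filter \<mu> = (if \<mu> = 0 then at_top else at_left (1 / (2 * \<mu>)))"

text \<open>Neither \<^const>\<open>Lim\<close> nor \<^const>\<open>real_of_ereal\<close> asserts anything about existence or finiteness of
  the limit; both have to be stated separately.\<close>

definition F_ext ::
  "'a::real_inner set \<Rightarrow> ('a \<Rightarrow> real) \<Rightarrow> ('a \<Rightarrow> 'a) \<Rightarrow> 'a \<Rightarrow> real" where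
  "F_ext S \<alpha> v x =
     real_of_ereal (Lim (eps_filter (mu_bar S \<alpha> v)) (\<lambda>\<epsilon>. F_eps S \<alpha> v \<epsilon> x))"

definition G_ext ::
  "'a::real_inner set \<Rightarrow> ('a \<Rightarrow> real) \<Rightarrow> ('a \<Rightarrow> 'a) \<Rightarrow> 'a \<Rightarrow> real" where
  "G_ext S \<alpha> v x = F_ext S \<alpha> v x - 1/2 * mu_bar S \<alpha> v * (norm x)\<^sup>2"

end

theory Submission
  imports Defs
begin

text \<open>Put \<open>\<mu> = mu_bar S \<alpha> v\<close> and write \<open>m\<close> for \<^const>\<open>f_tilde\<close>, the supremum of the affine functions of the
  tilted jet. Adding \<open>\<mu> / 2 * |x|\<^sup>2\<close> tilts the jet so strongly that each of its affine functions lies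
  below each of the functions \<open>\<alpha>t s + \<langle>vt s, y - s\<rangle> + \<mu> * |y - s|\<^sup>2\<close>, where \<open>(\<alpha>t, vt)\<close> is the tilted jet
  (\<open>tilted_jet_affine_below_paraboloid\<close>; \<open>\<mu>\<close> is the least constant that makes the quadratic form in
  this comparison nonnegative). Hence \<open>m\<close> is finite and convex, and it is caught between an affine
  function and a paraboloid of the jet that touch at \<open>s\<close>, for each \<open>s\<close> in \<open>S\<close>. Any function between
  \<open>m\<close> and these paraboloids extends the tilted jet.

  The Lasry-Lions formula for the parameter \<open>\<epsilon>\<close> is the infimum of all paraboloids of curvature
  \<open>\<kappa> = 1 / (2 * \<epsilon>)\<close> that lie above \<open>m\<close> (\<open>INF_SUP_eq_envelope\<close>). In this form its properties are
  immediate: it is convex because \<open>m\<close> is, it lies between \<open>m\<close> and every such paraboloid, and it grows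
  when \<open>\<kappa>\<close> decreases to \<open>\<mu>\<close>, so that the limit \<open>F\<close> exists. Paraboloids are written as
  \<open>c + \<langle>p, y - x\<rangle> + \<kappa> * |y - x|\<^sup>2\<close>, which makes sense for \<open>\<kappa> = 0\<close>; therefore the
  envelopes for \<open>\<mu> = 0\<close> are not a separate case.

  The limit is convex, and it is touched from above at every point by a paraboloid of curvature \<open>\<mu>\<close>
  (\<open>limit_envelope_paraboloid\<close>). The slope of this paraboloid is the limit of the slopes of almost
  optimal paraboloids for curvatures \<open>\<kappa> > \<mu>\<close>; the convexity of the envelopes makes these slopes a
  Cauchy sequence, and this is where completeness of the space enters. Convexity then gives the
  matching affine lower bound, so the slope is the gradient. For \<open>G = F - \<mu> / 2 * |x|\<^sup>2\<close> the two bounds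
  become a symmetric Taylor bound with constant \<open>\<mu> / 2\<close>.

  A symmetric Taylor bound with constant \<open>L / 2\<close> holds whenever the gradient is \<open>L\<close>-Lipschitz, and it
  bounds every term of \<^const>\<open>Gamma1\<close> by \<open>L\<close> (\<open>taylor_bound_Gamma1_term\<close>). This gives both
  \<open>Lip (\<nabla>G) \<le> \<mu>\<close> and the identity of \<^const>\<open>Gamma1\<close> on the whole space with \<^const>\<open>Lip\<close>. Finally
  \<open>2 * K1\<close> and \<open>K2\<close> are at most \<open>Gamma1 S \<alpha> v\<close>, whence \<open>\<mu>\<close> is at most \<open>2 + sqrt 5\<close> times that number, and
  \<open>2 + sqrt 5 \<le> (5 + sqrt 29) / 2\<close>.\<close>

section \<open>Gradients and second-order Taylor bounds\<close>

lemma GDERIV_unique: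
  assumes "GDERIV f x :> D" and "GDERIV f x :> D'"
  shows "D = D'"
proof -
  have "(\<lambda>h. inner h D) = (\<lambda>h. inner h D')"
    using assms unfolding gderiv_def by (rule has_derivative_unique)
  then have "inner (D - D') D = inner (D - D') D'"
    by meson
  then have "inner (D - D') (D - D') = 0"
    by (simp add: inner_diff_right)
  then show ?thesis by simp
qed

lemma grad_eqI: "GDERIV f x :> D \<Longrightarrow> grad f x = D"
  unfolding grad_def by (blast intro: GDERIV_unique)

lemma GDERIV_if_quadratic_error:
  assumes "\<And>y. \<bar>f y - f x - inner D (y - x)\<bar> \<le> C * (norm (y - x))\<^sup>2"
  shows "GDERIV f x :> D"
  unfolding gderiv_def
proof (rule has_derivativeI_sandwich[where e = 1 and H = "\<lambda>y. C * norm (y - x)"])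
  show "bounded_linear (\<lambda>h. inner h D)"
    by (rule bounded_linear_inner_left)
  show "norm ((f y - f x) - inner (y - x) D) / norm (y - x) \<le> C * norm (y - x)"
    if "y \<noteq> x" for y
    using assms[of y] that
    by (simp add: inner_commute[of "y - x"] divide_le_eq power2_eq_square mult.assoc)
  have "((\<lambda>y. C * norm (y - x)) \<longlongrightarrow> C * norm (x - x)) (at x)"
    by (intro tendsto_intros)
  then show "((\<lambda>y. C * norm (y - x)) \<longlongrightarrow> 0) (at x)" by simp
qed simp

definition taylor_bound :: "real \<Rightarrow> ('a::real_inner \<Rightarrow> real) \<Rightarrow> ('a \<Rightarrow> 'a) \<Rightarrow> bool" where
  "taylor_bound L f g \<longleftrightarrow> (\<forall>x y. \<bar>f y - f x - inner (g x) (y - x)\<bar> \<le> L / 2 * (norm (y - x))\<^sup>2)"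

lemma taylor_bound_GDERIV: "taylor_bound L f g \<Longrightarrow> GDERIV f x :> g x"
  unfolding taylor_bound_def by (intro GDERIV_if_quadratic_error) blast

lemma lipschitz_gradient_upper_bound:
  assumes deriv: "\<And>x. GDERIV f x :> g x" and lip: "L-lipschitz_on UNIV g"
  shows "f y - f x - inner (g x) (y - x) \<le> L / 2 * (norm (y - x))\<^sup>2"
proof -
  define d where "d = y - x"
  define \<phi> where "\<phi> t = f (x + t *\<^sub>R d) - t * inner (g x) d - L / 2 * t\<^sup>2 * (norm d)\<^sup>2" for t :: real
  have "\<phi> 0 \<ge> \<phi> 1"
  proof (rule DERIV_nonpos_imp_nonincreasing[where f = \<phi>])
    fix t :: real
    assume t: "0 \<le> t" "t \<le> 1"
    have "((\<lambda>t. x + t *\<^sub>R d) has_derivative (\<lambda>h. h *\<^sub>R d)) (at t)"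
      by (auto intro!: derivative_eq_intros)
    then have "((\<lambda>t. f (x + t *\<^sub>R d)) has_derivative (\<lambda>h. inner (h *\<^sub>R d) (g (x + t *\<^sub>R d)))) (at t)"
      using deriv[of "x + t *\<^sub>R d"] unfolding gderiv_def by (rule has_derivative_compose)
    then have "((\<lambda>t. f (x + t *\<^sub>R d)) has_real_derivative inner (g (x + t *\<^sub>R d)) d) (at t)"
      by (simp add: has_field_derivative_def inner_commute mult_commute_abs mult.commute)
    then have "(\<phi> has_real_derivative
        (inner (g (x + t *\<^sub>R d)) d - inner (g x) d - L * t * (norm d)\<^sup>2)) (at t)"
      unfolding \<phi>_def by (auto intro!: derivative_eq_intros)
    moreover have "inner (g (x + t *\<^sub>R d)) d - inner (g x) d \<le> L * t * (norm d)\<^sup>2"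
    proof -
      have "inner (g (x + t *\<^sub>R d) - g x) d \<le> norm (g (x + t *\<^sub>R d) - g x) * norm d"
        by (rule norm_cauchy_schwarz)
      also have "\<dots> \<le> (L * norm (t *\<^sub>R d)) * norm d"
        using lipschitz_onD[OF lip, of "x + t *\<^sub>R d" x]
        by (intro mult_right_mono) (auto simp: dist_norm)
      finally show ?thesis using t by (simp add: inner_diff_left power2_eq_square mult.assoc)
    qed
    ultimately show "\<exists>D. (\<phi> has_real_derivative D) (at t) \<and> D \<le> 0"
      by (intro exI conjI) auto
  qed simp
  then show ?thesis by (simp add: \<phi>_def d_def)
qed

lemma lipschitz_gradient_taylor_bound:
  assumes deriv: "\<And>x. GDERIV f x :> g x" and lip: "L-lipschitz_on UNIV g"
  shows "taylor_bound L f g"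
  unfolding taylor_bound_def
proof (intro allI)
  fix x y
  have "L-lipschitz_on UNIV (\<lambda>x. - g x)"
    using lip by (simp add: lipschitz_on_def dist_minus)
  from lipschitz_gradient_upper_bound[OF GDERIV_minus[OF deriv] this, of y x]
    lipschitz_gradient_upper_bound[OF deriv lip, of y x]
  show "\<bar>f y - f x - inner (g x) (y - x)\<bar> \<le> L / 2 * (norm (y - x))\<^sup>2"
    unfolding inner_minus_left by linarith
qed

text \<open>Two Taylor bounds, one from above based at \<open>s\<close> and one from below based at \<open>t\<close>, are compared
  at a common point \<open>z\<close>. Of all choices, the midpoint shifted by \<open>(g t - g s) / (2 * L)\<close> maximizes
  the resulting bound. The gain \<open>|g t - g s|\<^sup>2 / (4 * L)\<close> is what controls the difference of the
  gradients, with the optimal constant.\<close>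

lemma taylor_bound_two_points:
  assumes taylor: "taylor_bound L f g" and L: "L > 0"
  shows "(norm (g t - g s))\<^sup>2 / (4 * L) - L / 4 * (norm (s - t))\<^sup>2
    \<le> f s - f t - inner (g s + g t) (s - t) / 2"
proof -
  define h where "h = (1 / (2 * L)) *\<^sub>R (g t - g s)"
  define e where "e = (1 / 2) *\<^sub>R (s - t)"
  define z where "z = t + h + e"
  have zt: "z - t = h + e" by (simp add: z_def)
  have st: "s - t = 2 *\<^sub>R e" by (simp add: e_def)
  have "z - s = (z - t) - (s - t)" by simp
  then have zs: "z - s = h - e" unfolding zt st by (simp add: scaleR_2)
  have gg: "g t - g s = (2 * L) *\<^sub>R h" using L by (simp add: h_def)
  then have gt: "g t = g s + (2 * L) *\<^sub>R h" by (simp add: algebra_simps)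
  have "f z - f s - inner (g s) (h - e) \<le> L / 2 * (norm (h - e))\<^sup>2"
    using taylor[unfolded taylor_bound_def, rule_format, of z s] unfolding zs by linarith
  moreover have "- (f z - f t - inner (g t) (h + e)) \<le> L / 2 * (norm (h + e))\<^sup>2"
    using taylor[unfolded taylor_bound_def, rule_format, of z t] unfolding zt by linarith
  moreover have "(norm (g t - g s))\<^sup>2 / (4 * L) = L * (norm h)\<^sup>2"
    using L by (simp add: gg power2_eq_square)
  moreover have "L / 4 * (norm (s - t))\<^sup>2 = L * (norm e)\<^sup>2"
    by (simp add: st power2_eq_square)
  moreover have "inner (g s + g t) (s - t) / 2 = 2 * inner (g s) e + 2 * L * inner h e"
    by (simp add: st gt inner_simps)
  moreover have "inner (g t) (h + e) - inner (g s) (h - e)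
      = 2 * inner (g s) e + 2 * L * (norm h)\<^sup>2 + 2 * L * inner h e"
    by (simp add: gt inner_simps power2_norm_eq_inner algebra_simps)
  moreover have "L / 2 * (norm (h + e))\<^sup>2 + L / 2 * (norm (h - e))\<^sup>2 = L * (norm h)\<^sup>2 + L * (norm e)\<^sup>2"
    by (simp add: power2_norm_eq_inner inner_simps inner_commute[of e h] field_simps)
  ultimately show ?thesis by linarith
qed

lemma coefA_swap: "coefA a w t s = - coefA a w s t"
proof -
  have "2 * (a t - a s) + inner (w t + w s) (s - t) = - (2 * (a s - a t) + inner (w s + w t) (t - s))"
    by (simp add: inner_simps)
  then show ?thesis
    by (simp add: coefA_def norm_minus_commute[of t s] minus_divide_left)
qed

lemma norm_coefB: "norm (coefB w s t) = norm (w s - w t) / norm (s - t)"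
  by (simp add: coefB_def divide_inverse mult.commute)

lemma taylor_bound_coefA:
  assumes taylor: "taylor_bound L f g" and L: "L > 0" and "s \<noteq> t"
  shows "2 * L * \<bar>coefA f g s t\<bar> + (norm (coefB g s t))\<^sup>2 \<le> L\<^sup>2"
proof -
  have half: "(norm (coefB g s t))\<^sup>2 - L\<^sup>2 \<le> 2 * L * coefA f g s t" if "s \<noteq> t" for s t
  proof -
    have A: "coefA f g s t * (norm (s - t))\<^sup>2 = 2 * (f s - f t) - inner (g s + g t) (s - t)"
      using that by (simp add: coefA_def inner_simps)
    have B: "(norm (coefB g s t))\<^sup>2 * (norm (s - t))\<^sup>2 = (norm (g t - g s))\<^sup>2"
      using that by (simp add: norm_coefB power_divide norm_minus_commute)
    have "(norm (g t - g s))\<^sup>2 - L\<^sup>2 * (norm (s - t))\<^sup>2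
        \<le> 2 * L * (2 * (f s - f t) - inner (g s + g t) (s - t))"
    proof -
      have "(norm (g t - g s))\<^sup>2 - L\<^sup>2 * (norm (s - t))\<^sup>2
          = (4 * L) * ((norm (g t - g s))\<^sup>2 / (4 * L) - L / 4 * (norm (s - t))\<^sup>2)"
        using L by (simp add: right_diff_distrib power2_eq_square)
      also have "\<dots> \<le> (4 * L) * (f s - f t - inner (g s + g t) (s - t) / 2)"
        using taylor_bound_two_points[OF taylor L] L by (intro mult_left_mono) auto
      also have "\<dots> = 2 * L * (2 * (f s - f t) - inner (g s + g t) (s - t))"
        by (simp add: right_diff_distrib)
      finally show ?thesis .
    qed
    then have "((norm (coefB g s t))\<^sup>2 - L\<^sup>2) * (norm (s - t))\<^sup>2
        \<le> (2 * L) * coefA f g s t * (norm (s - t))\<^sup>2"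
      by (simp only: left_diff_distrib mult.assoc[of "2 * L"] A B)
    then show ?thesis
      using that by (simp add: mult_le_cancel_right)
  qed
  have "norm (coefB g t s) = norm (coefB g s t)"
    by (simp add: norm_coefB norm_minus_commute)
  then show ?thesis
    using half[OF \<open>s \<noteq> t\<close>] half[OF \<open>s \<noteq> t\<close>[symmetric]] by (auto simp: coefA_swap[of f g t s] abs_if)
qed

lemma taylor_bound_Gamma1_term:
  assumes taylor: "taylor_bound L f g" and L: "L \<ge> 0" and "s \<noteq> t"
  shows "sqrt ((coefA f g s t)\<^sup>2 + (norm (coefB g s t))\<^sup>2) + \<bar>coefA f g s t\<bar> \<le> L"
proof (rule field_le_epsilon)
  fix e :: real
  assume "e > 0"
  \<comment> \<open>The slack \<open>e\<close> covers the degenerate constant \<open>L = 0\<close>.\<close>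
  define M where "M = L + e"
  have M: "M > 0" using L \<open>e > 0\<close> by (simp add: M_def)
  have "taylor_bound M f g"
    unfolding taylor_bound_def
  proof (intro allI)
    fix x y
    have "\<bar>f y - f x - inner (g x) (y - x)\<bar> \<le> L / 2 * (norm (y - x))\<^sup>2"
      using taylor by (simp add: taylor_bound_def)
    also have "\<dots> \<le> M / 2 * (norm (y - x))\<^sup>2"
      using \<open>e > 0\<close> by (intro mult_right_mono) (auto simp: M_def)
    finally show "\<bar>f y - f x - inner (g x) (y - x)\<bar> \<le> M / 2 * (norm (y - x))\<^sup>2" .
  qed
  from taylor_bound_coefA[OF this M \<open>s \<noteq> t\<close>]
  have *: "2 * M * \<bar>coefA f g s t\<bar> + (norm (coefB g s t))\<^sup>2 \<le> M\<^sup>2" .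
  then have "2 * M * \<bar>coefA f g s t\<bar> \<le> M * M"
    using zero_le_power2[of "norm (coefB g s t)"] unfolding power2_eq_square[of M] by linarith
  then have "M * (2 * \<bar>coefA f g s t\<bar>) \<le> M * M" by (simp add: mult_ac)
  then have "2 * \<bar>coefA f g s t\<bar> \<le> M" using M by (rule mult_left_le_imp_le)
  then have "0 \<le> M - \<bar>coefA f g s t\<bar>" by linarith
  moreover have "(coefA f g s t)\<^sup>2 + (norm (coefB g s t))\<^sup>2 \<le> (M - \<bar>coefA f g s t\<bar>)\<^sup>2"
    using * by (simp add: power2_diff mult_ac)
  ultimately have "sqrt ((coefA f g s t)\<^sup>2 + (norm (coefB g s t))\<^sup>2) \<le> M - \<bar>coefA f g s t\<bar>"
    by (simp add: real_le_lsqrt)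
  then show "sqrt ((coefA f g s t)\<^sup>2 + (norm (coefB g s t))\<^sup>2) + \<bar>coefA f g s t\<bar> \<le> L + e"
    by (simp add: M_def)
qed

lemma norm_coefB_le_Gamma1_term:
  "norm (coefB w s t) + \<bar>coefA a w s t\<bar>
    \<le> sqrt ((coefA a w s t)\<^sup>2 + (norm (coefB w s t))\<^sup>2) + \<bar>coefA a w s t\<bar>"
  using real_sqrt_sum_squares_ge2[of "norm (coefB w s t)" "coefA a w s t"] by simp

lemma taylor_bound_lipschitz:
  assumes "taylor_bound L f g" and "L \<ge> 0"
  shows "L-lipschitz_on UNIV g"
proof (rule lipschitz_onI)
  fix x y
  show "dist (g x) (g y) \<le> L * dist x y"
  proof (cases "x = y")
    case False
    have "norm (coefB g x y) \<le> L"
      using taylor_bound_Gamma1_term[OF assms False] norm_coefB_le_Gamma1_term[of g x y f] by linarith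
    then show ?thesis
      using False by (simp add: norm_coefB dist_norm divide_le_eq)
  qed simp
qed fact

lemma Gamma1_term_le:
  assumes "Gamma1 T a w \<le> ennreal r" and "r \<ge> 0" and "s \<in> T" "t \<in> T" "s \<noteq> t"
  shows "sqrt ((coefA a w s t)\<^sup>2 + (norm (coefB w s t))\<^sup>2) + \<bar>coefA a w s t\<bar> \<le> r"
proof -
  have "(s, t) \<in> distinct_pairs T" using assms by (simp add: distinct_pairs_def)
  then have "ennreal (sqrt ((coefA a w s t)\<^sup>2 + (norm (coefB w s t))\<^sup>2) + \<bar>coefA a w s t\<bar>) \<le> Gamma1 T a w"
    unfolding Gamma1_def by (rule SUP_upper2) simp
  then have "ennreal (sqrt ((coefA a w s t)\<^sup>2 + (norm (coefB w s t))\<^sup>2) + \<bar>coefA a w s t\<bar>) \<le> ennreal r"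
    using assms(1) by (rule order_trans)
  then show ?thesis using \<open>r \<ge> 0\<close> by (simp add: ennreal_le_iff del: ennreal_plus)
qed

text \<open>On the whole space the inequality \<open>\<le>\<close> is the two-point estimate above; the converse holds
  because the norm of \<^const>\<open>coefB\<close>, the difference quotient of the gradient, is at most the
  corresponding term of \<^const>\<open>Gamma1\<close>.\<close>

lemma Gamma1_UNIV_eq_Lip:
  assumes deriv: "\<And>x. GDERIV f x :> g x"
  shows "Gamma1 UNIV f g = Lip g"
proof (rule antisym)
  show "Gamma1 UNIV f g \<le> Lip g"
    unfolding Lip_def
  proof (rule INF_greatest)
    fix L
    assume "L \<in> {L. L-lipschitz_on UNIV g}"
    then have lip: "L-lipschitz_on UNIV g" by simp
    then have "taylor_bound L f g" by (rule lipschitz_gradient_taylor_bound[OF deriv])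
    then show "Gamma1 UNIV f g \<le> ennreal L"
      unfolding Gamma1_def distinct_pairs_def
      by (intro SUP_least)
        (auto intro!: ennreal_leI taylor_bound_Gamma1_term lipschitz_on_nonneg[OF lip] simp del: ennreal_plus)
  qed
  show "Lip g \<le> Gamma1 UNIV f g"
  proof (cases "Gamma1 UNIV f g")
    case (real r)
    have "r-lipschitz_on UNIV g"
    proof (rule lipschitz_onI)
      fix x y
      show "dist (g x) (g y) \<le> r * dist x y"
      proof (cases "x = y")
        case False
        have "Gamma1 UNIV f g \<le> ennreal r" using real by simp
        from Gamma1_term_le[OF this real(1) UNIV_I UNIV_I False]
        have "norm (coefB g x y) \<le> r"
          using norm_coefB_le_Gamma1_term[of g x y f] by linarith
        then show ?thesis
          using False by (simp add: norm_coefB dist_norm divide_le_eq)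
      qed simp
    qed (use real in simp)
    then show ?thesis
      unfolding real(2) Lip_def by (intro INF_lower) simp
  qed simp
qed

section \<open>Envelopes of convex functions by paraboloids\<close>

text \<open>A paraboloid is described by its value \<open>c\<close> and slope \<open>p\<close> at a base point \<open>x\<close> instead of by its
  vertex, so that curvature \<open>0\<close> is not exceptional.\<close>

definition paraboloid_above ::
  "('a::real_inner \<Rightarrow> real) \<Rightarrow> real \<Rightarrow> 'a \<Rightarrow> real \<Rightarrow> 'a \<Rightarrow> bool" where
  "paraboloid_above m \<kappa> x c p \<longleftrightarrow> (\<forall>y. m y \<le> c + inner p (y - x) + \<kappa> * (norm (y - x))\<^sup>2)"

definition envelope :: "('a::real_inner \<Rightarrow> real) \<Rightarrow> real \<Rightarrow> 'a \<Rightarrow> real" where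
  "envelope m \<kappa> x = Inf {c. \<exists>p. paraboloid_above m \<kappa> x c p}"

lemma paraboloid_above_rebase:
  assumes "paraboloid_above m \<kappa> x c p"
  shows "paraboloid_above m \<kappa> x' (c + inner p (x' - x) + \<kappa> * (norm (x' - x))\<^sup>2)
    (p + (2 * \<kappa>) *\<^sub>R (x' - x))"
  unfolding paraboloid_above_def
proof
  fix y
  define d where "d = x' - x"
  define h where "h = y - x'"
  have yx: "y - x = h + d" by (simp add: d_def h_def)
  have "m y \<le> c + inner p (h + d) + \<kappa> * (norm (h + d))\<^sup>2"
    using assms[unfolded paraboloid_above_def, rule_format, of y] by (simp only: yx)
  also have "\<dots> = c + inner p d + \<kappa> * (norm d)\<^sup>2 + inner (p + (2 * \<kappa>) *\<^sub>R d) h + \<kappa> * (norm h)\<^sup>2"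
    by (simp add: power2_norm_eq_inner inner_add_left inner_add_right inner_commute[of h d]
        distrib_left)
  finally show "m y \<le> c + inner p (x' - x) + \<kappa> * (norm (x' - x))\<^sup>2
      + inner (p + (2 * \<kappa>) *\<^sub>R (x' - x)) (y - x') + \<kappa> * (norm (y - x'))\<^sup>2"
    by (simp only: d_def h_def)
qed

lemma paraboloid_above_mono:
  assumes "paraboloid_above m \<kappa> x c p" and "\<kappa> \<le> \<kappa>'"
  shows "paraboloid_above m \<kappa>' x c p"
  unfolding paraboloid_above_def
proof
  fix y
  have "m y \<le> c + inner p (y - x) + \<kappa> * (norm (y - x))\<^sup>2"
    using assms(1) by (simp add: paraboloid_above_def)
  also have "\<dots> \<le> c + inner p (y - x) + \<kappa>' * (norm (y - x))\<^sup>2"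
    using assms(2) by (simp add: mult_right_mono)
  finally show "m y \<le> c + inner p (y - x) + \<kappa>' * (norm (y - x))\<^sup>2" .
qed

lemma paraboloid_above_base: "paraboloid_above m \<kappa> x c p \<Longrightarrow> m x \<le> c"
  unfolding paraboloid_above_def by (drule spec[of _ x]) simp

lemma envelope_le: "paraboloid_above m \<kappa> x c p \<Longrightarrow> envelope m \<kappa> x \<le> c"
  unfolding envelope_def
  by (rule cInf_lower) (auto intro!: bdd_belowI[of _ "m x"] dest: paraboloid_above_base)

lemma envelope_le_paraboloid:
  "paraboloid_above m \<kappa> x c p \<Longrightarrow> envelope m \<kappa> y \<le> c + inner p (y - x) + \<kappa> * (norm (y - x))\<^sup>2"
  by (rule envelope_le[OF paraboloid_above_rebase])

text \<open>The infimum over centres \<open>z\<close> and the supremum over \<open>y\<close> of the Lasry-Lions formula only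
  encode the paraboloids above \<open>m\<close>: for each \<open>z\<close>, the inner supremum is the value at \<open>x\<close> of the
  lowest paraboloid of curvature \<open>\<kappa>\<close> with vertex \<open>z\<close> above \<open>m\<close>.\<close>

lemma INF_SUP_eq_envelope:
  assumes "\<kappa> > 0" and ex: "\<exists>c p. paraboloid_above m \<kappa> x c p"
  shows "(INF z. SUP y. ereal (m y) - ereal (\<kappa> * (norm (y - z))\<^sup>2) + ereal (\<kappa> * (norm (z - x))\<^sup>2))
    = ereal (envelope m \<kappa> x)"
proof (rule antisym)
  let ?V = "INF z. SUP y. ereal (m y) - ereal (\<kappa> * (norm (y - z))\<^sup>2) + ereal (\<kappa> * (norm (z - x))\<^sup>2)"
  have upper: "?V \<le> ereal c" if above: "paraboloid_above m \<kappa> x c p" for c p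
  proof -
    define q where "q = (1 / (2 * \<kappa>)) *\<^sub>R p"
    have p: "p = (2 * \<kappa>) *\<^sub>R q" using \<open>\<kappa> > 0\<close> by (simp add: q_def)
    \<comment> \<open>The vertex of the paraboloid with slope \<open>p\<close> at \<open>x\<close>.\<close>
    define z where "z = x - q"
    have "m y - \<kappa> * (norm (y - z))\<^sup>2 + \<kappa> * (norm (z - x))\<^sup>2 \<le> c" for y
    proof -
      define h where "h = y - x"
      have "m y \<le> c + inner p h + \<kappa> * (norm h)\<^sup>2"
        using above by (simp add: paraboloid_above_def h_def)
      moreover have "y - z = h + q" "z - x = - q" by (simp_all add: z_def h_def)
      ultimately show ?thesis
        by (simp add: p power2_norm_eq_inner inner_add_left inner_add_right inner_commute[of h q]
            distrib_left)
    qed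
    then have "(SUP y. ereal (m y) - ereal (\<kappa> * (norm (y - z))\<^sup>2) + ereal (\<kappa> * (norm (z - x))\<^sup>2)) \<le> ereal c"
      by (intro SUP_least) simp
    then show ?thesis by (rule INF_lower2[OF UNIV_I])
  qed
  show "?V \<le> ereal (envelope m \<kappa> x)"
  proof (rule ereal_le_epsilon2)
    fix e :: real
    assume "e > 0"
    have "{c. \<exists>p. paraboloid_above m \<kappa> x c p} \<noteq> {}" using ex by auto
    then obtain c where "c \<in> {c. \<exists>p. paraboloid_above m \<kappa> x c p}" "c < envelope m \<kappa> x + e"
      unfolding envelope_def using cInf_lessD[of _ "Inf {c. \<exists>p. paraboloid_above m \<kappa> x c p} + e"] \<open>e > 0\<close>
      by (metis less_add_same_cancel1)
    then show "?V \<le> ereal (envelope m \<kappa> x) + ereal e"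
      using upper order_trans[of ?V "ereal c" "ereal (envelope m \<kappa> x + e)"] by auto
  qed
  show "ereal (envelope m \<kappa> x) \<le> ?V"
  proof (rule INF_greatest)
    fix z
    let ?W = "SUP y. ereal (m y) - ereal (\<kappa> * (norm (y - z))\<^sup>2) + ereal (\<kappa> * (norm (z - x))\<^sup>2)"
    have le: "ereal (m y) - ereal (\<kappa> * (norm (y - z))\<^sup>2) + ereal (\<kappa> * (norm (z - x))\<^sup>2) \<le> ?W" for y
      by (rule SUP_upper) simp
    show "ereal (envelope m \<kappa> x) \<le> ?W"
    proof (cases ?W)
      case (real c)
      have "paraboloid_above m \<kappa> x c ((2 * \<kappa>) *\<^sub>R (x - z))"
        unfolding paraboloid_above_def
      proof
        fix y
        define h where "h = y - x"
        define u where "u = x - z"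
        have "y - z = h + u" "z - x = - u" by (simp_all add: h_def u_def)
        moreover have "m y - \<kappa> * (norm (y - z))\<^sup>2 + \<kappa> * (norm (z - x))\<^sup>2 \<le> c"
          using le[of y] unfolding real by simp
        ultimately have "m y \<le> c + inner ((2 * \<kappa>) *\<^sub>R u) h + \<kappa> * (norm h)\<^sup>2"
          by (simp add: power2_norm_eq_inner inner_add_left inner_add_right inner_commute[of h u]
              distrib_left)
        then show "m y \<le> c + inner ((2 * \<kappa>) *\<^sub>R (x - z)) (y - x) + \<kappa> * (norm (y - x))\<^sup>2"
          by (simp only: h_def u_def)
      qed
      then show ?thesis unfolding real by (simp add: envelope_le)
    next
      case MInf
      then show ?thesis using le[of x] by simp
    qed simp
  qed
qed

locale convex_below_paraboloid =
  fixes m :: "'a::{real_inner, complete_space} \<Rightarrow> real" and \<mu> :: real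
  assumes convex: "convex_on UNIV m"
    and above: "\<exists>x c p. paraboloid_above m \<mu> x c p"
    and mu_nonneg: "\<mu> \<ge> 0"
begin

lemma ex_paraboloid_above:
  assumes "\<mu> \<le> \<kappa>"
  shows "\<exists>c p. paraboloid_above m \<kappa> x c p"
proof -
  obtain y c p where "paraboloid_above m \<mu> y c p" using above by blast
  from paraboloid_above_mono[OF paraboloid_above_rebase[OF this] assms]
  show ?thesis by blast
qed

lemma le_envelope: "\<mu> \<le> \<kappa> \<Longrightarrow> m x \<le> envelope m \<kappa> x"
  unfolding envelope_def
  using ex_paraboloid_above[of \<kappa> x]
  by (intro cInf_greatest) (auto dest: paraboloid_above_base)

lemma envelope_approx:
  assumes "\<mu> \<le> \<kappa>" and "\<delta> > 0"
  obtains c p where "paraboloid_above m \<kappa> x c p" and "c < envelope m \<kappa> x + \<delta>"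
proof -
  have "\<exists>c\<in>{c. \<exists>p. paraboloid_above m \<kappa> x c p}. c < envelope m \<kappa> x + \<delta>"
    unfolding envelope_def
    using ex_paraboloid_above[OF assms(1), of x] \<open>\<delta> > 0\<close> by (intro cInf_lessD) auto
  then show ?thesis using that by blast
qed

lemma envelope_antimono:
  assumes "\<mu> \<le> \<kappa>" and "\<kappa> \<le> \<kappa>'"
  shows "envelope m \<kappa>' x \<le> envelope m \<kappa> x"
proof (rule field_le_epsilon)
  fix e :: real
  assume "e > 0"
  then obtain c p where "paraboloid_above m \<kappa> x c p" and "c < envelope m \<kappa> x + e"
    using envelope_approx[OF assms(1)] by blast
  then show "envelope m \<kappa>' x \<le> envelope m \<kappa> x + e"
    using envelope_le[OF paraboloid_above_mono[OF _ assms(2)]] by fastforce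
qed

text \<open>Since \<open>m\<close> is convex, a convex combination of paraboloids of equal curvature above \<open>m\<close>, each
  moved so that the base points agree, is again above \<open>m\<close>.\<close>

lemma convex_on_envelope:
  assumes "\<mu> \<le> \<kappa>"
  shows "convex_on UNIV (envelope m \<kappa>)"
proof (rule convex_onI)
  fix t :: real and x y :: 'a
  assume t: "0 < t" "t < 1"
  show "envelope m \<kappa> ((1 - t) *\<^sub>R x + t *\<^sub>R y) \<le> (1 - t) * envelope m \<kappa> x + t * envelope m \<kappa> y"
  proof (rule field_le_epsilon)
    fix e :: real
    assume "e > 0"
    obtain c p where cp: "paraboloid_above m \<kappa> x c p" "c < envelope m \<kappa> x + e"
      using envelope_approx[OF assms \<open>e > 0\<close>] by blast
    obtain d q where dq: "paraboloid_above m \<kappa> y d q" "d < envelope m \<kappa> y + e"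
      using envelope_approx[OF assms \<open>e > 0\<close>] by blast
    define z where "z = (1 - t) *\<^sub>R x + t *\<^sub>R y"
    have "paraboloid_above m \<kappa> z ((1 - t) * c + t * d) ((1 - t) *\<^sub>R p + t *\<^sub>R q)"
      unfolding paraboloid_above_def
    proof
      fix w
      define h where "h = w - z"
      have w: "w = (1 - t) *\<^sub>R (x + h) + t *\<^sub>R (y + h)"
        by (simp add: h_def z_def algebra_simps)
      have "m w \<le> (1 - t) * m (x + h) + t * m (y + h)"
        using convex_onD[OF convex, of t "x + h" "y + h"] t by (simp add: w)
      also have "\<dots> \<le> (1 - t) * (c + inner p h + \<kappa> * (norm h)\<^sup>2) + t * (d + inner q h + \<kappa> * (norm h)\<^sup>2)"
        using cp(1)[unfolded paraboloid_above_def, rule_format, of "x + h"]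
          dq(1)[unfolded paraboloid_above_def, rule_format, of "y + h"] t
        by (intro add_mono mult_left_mono) auto
      also have "\<dots> = (1 - t) * c + t * d + inner ((1 - t) *\<^sub>R p + t *\<^sub>R q) h + \<kappa> * (norm h)\<^sup>2"
        by (simp add: inner_add_left algebra_simps)
      finally show "m w \<le> (1 - t) * c + t * d + inner ((1 - t) *\<^sub>R p + t *\<^sub>R q) (w - z)
          + \<kappa> * (norm (w - z))\<^sup>2"
        by (simp only: h_def)
    qed
    then have "envelope m \<kappa> z \<le> (1 - t) * c + t * d" by (rule envelope_le)
    also have "\<dots> \<le> (1 - t) * (envelope m \<kappa> x + e) + t * (envelope m \<kappa> y + e)"
      using cp dq t by (intro add_mono mult_left_mono) auto
    finally show "envelope m \<kappa> ((1 - t) *\<^sub>R x + t *\<^sub>R y)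
        \<le> (1 - t) * envelope m \<kappa> x + t * envelope m \<kappa> y + e"
      by (simp add: z_def algebra_simps)
  qed
qed simp

text \<open>A supremum rather than a limit: the envelopes increase as the curvature decreases to \<open>\<mu>\<close>.\<close>

definition limit_envelope :: "'a \<Rightarrow> real" where
  "limit_envelope x = (SUP \<kappa>\<in>{\<mu><..}. envelope m \<kappa> x)"

lemma envelope_le_limit: "\<mu> < \<kappa> \<Longrightarrow> envelope m \<kappa> x \<le> limit_envelope x"
  unfolding limit_envelope_def
  by (rule cSUP_upper) (auto intro!: bdd_aboveI2[of _ _ "envelope m \<mu> x"] envelope_antimono)

lemma limit_le_envelope: "limit_envelope x \<le> envelope m \<mu> x"
  unfolding limit_envelope_def by (rule cSUP_least) (auto intro!: envelope_antimono)

lemma le_limit_envelope: "m x \<le> limit_envelope x"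
  using le_envelope[of "\<mu> + 1" x] envelope_le_limit[of "\<mu> + 1" x] by simp

lemma limit_envelope_le_paraboloid:
  "paraboloid_above m \<mu> x c p \<Longrightarrow> limit_envelope y \<le> c + inner p (y - x) + \<mu> * (norm (y - x))\<^sup>2"
  using envelope_le_paraboloid limit_le_envelope order_trans by blast

lemma tendsto_limit_envelope: "((\<lambda>\<kappa>. envelope m \<kappa> x) \<longlongrightarrow> limit_envelope x) (at_right \<mu>)"
proof (rule order_tendstoI)
  fix a
  assume "a < limit_envelope x"
  then obtain \<kappa> where \<kappa>: "\<kappa> > \<mu>" "a < envelope m \<kappa> x"
    unfolding limit_envelope_def
    by (subst (asm) less_cSUP_iff)
      (auto intro!: bdd_aboveI2[of _ _ "envelope m \<mu> x"] envelope_antimono)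
  have "\<forall>\<^sub>F k in at_right \<mu>. k \<in> {\<mu><..<\<kappa>}" using \<kappa>(1) by (rule eventually_at_right_real)
  then show "\<forall>\<^sub>F k in at_right \<mu>. a < envelope m k x"
  proof eventually_elim
    case (elim k)
    then have "envelope m \<kappa> x \<le> envelope m k x" by (intro envelope_antimono) auto
    then show ?case using \<kappa>(2) by simp
  qed
next
  fix a
  assume a: "limit_envelope x < a"
  have "\<forall>\<^sub>F k in at_right \<mu>. k > \<mu>" by (simp add: eventually_at_right_less)
  then show "\<forall>\<^sub>F k in at_right \<mu>. envelope m k x < a"
    by eventually_elim (use a envelope_le_limit[of _ x] in fastforce)
qed

lemma convex_on_limit_envelope: "convex_on UNIV limit_envelope"
proof (rule convex_onI)
  fix t :: real and x y :: 'a
  assume t: "0 < t" "t < 1"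
  show "limit_envelope ((1 - t) *\<^sub>R x + t *\<^sub>R y) \<le> (1 - t) * limit_envelope x + t * limit_envelope y"
  proof (rule tendsto_le[of "at_right \<mu>"])
    show "((\<lambda>\<kappa>. (1 - t) * envelope m \<kappa> x + t * envelope m \<kappa> y)
        \<longlongrightarrow> (1 - t) * limit_envelope x + t * limit_envelope y) (at_right \<mu>)"
      by (intro tendsto_intros tendsto_limit_envelope)
    have "\<forall>\<^sub>F k in at_right \<mu>. k > \<mu>" by (simp add: eventually_at_right_less)
    then show "\<forall>\<^sub>F k in at_right \<mu>. envelope m k ((1 - t) *\<^sub>R x + t *\<^sub>R y)
        \<le> (1 - t) * envelope m k x + t * envelope m k y"
      by eventually_elim (use convex_onD[OF convex_on_envelope, of _ t x y] t in auto)
  qed (auto simp: tendsto_limit_envelope)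
qed simp

text \<open>This bound makes the slopes at \<open>x\<close> of almost optimal paraboloids a Cauchy sequence. Add one
  paraboloid evaluated at \<open>x + h\<close> to another one evaluated at \<open>x - h\<close>: convexity bounds the sum of the
  envelope values from below by twice the value at \<open>x\<close>, so the difference of the slopes can have
  only a small component along \<open>h\<close>, for every \<open>h\<close>. In this way the gradient of the limit is obtained
  without a separation theorem and without representing linear functionals.\<close>

lemma slope_difference_bound:
  assumes "\<mu> < \<kappa>" "\<kappa> \<le> \<kappa>'" "\<kappa>' \<le> \<mu> + 1"
    and P: "paraboloid_above m \<kappa>' x c' p'" "c' \<le> envelope m \<kappa>' x + \<delta>"
    and Q: "paraboloid_above m \<kappa> x c p" "c \<le> envelope m \<kappa> x + \<delta>"
  shows "(norm (p - p'))\<^sup>2 \<le> 8 * (\<mu> + 1) * (2 * \<delta> + (limit_envelope x - envelope m \<kappa>' x))"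
proof -
  define K where "K = \<mu> + 1"
  have K: "K > 0" using mu_nonneg by (simp add: K_def)
  \<comment> \<open>The maximizer of \<open>inner (p - p') h - 2 * K * (norm h)\<^sup>2\<close>.\<close>
  define h where "h = (1 / (4 * K)) *\<^sub>R (p - p')"
  let ?E = "envelope m \<kappa>'"
  have "?E ((1 - 1/2) *\<^sub>R (x + h) + (1/2) *\<^sub>R (x - h)) \<le> (1 - 1/2) * ?E (x + h) + 1/2 * ?E (x - h)"
    using assms by (intro convex_onD[OF convex_on_envelope]) auto
  moreover have "(1 - 1/2) *\<^sub>R (x + h) + (1/2) *\<^sub>R (x - h) = x"
    by (simp add: scaleR_add_right scaleR_diff_right flip: scaleR_add_left)
  ultimately have "2 * ?E x \<le> ?E (x + h) + ?E (x - h)"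
    by (simp add: field_simps)
  moreover have "?E (x + h) \<le> c' + inner p' h + \<kappa>' * (norm h)\<^sup>2"
    using envelope_le_paraboloid[OF P(1), of "x + h"] by simp
  moreover have "?E (x - h) \<le> c - inner p h + \<kappa> * (norm h)\<^sup>2"
    using envelope_le_paraboloid[OF Q(1), of "x - h"] envelope_antimono[of \<kappa> \<kappa>' "x - h"] assms by simp
  moreover have "\<kappa> * (norm h)\<^sup>2 \<le> K * (norm h)\<^sup>2" "\<kappa>' * (norm h)\<^sup>2 \<le> K * (norm h)\<^sup>2"
    using assms by (auto intro!: mult_right_mono simp: K_def)
  moreover have "envelope m \<kappa> x \<le> limit_envelope x"
    using assms by (intro envelope_le_limit)
  ultimately have "inner (p - p') h - 2 * K * (norm h)\<^sup>2 \<le> 2 * \<delta> + (limit_envelope x - ?E x)"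
    using P(2) Q(2) by (simp add: inner_diff_left)
  moreover have "inner (p - p') h = (norm (p - p'))\<^sup>2 / (4 * K)"
    by (simp add: h_def power2_norm_eq_inner)
  moreover have "2 * K * (norm h)\<^sup>2 = (norm (p - p'))\<^sup>2 / (8 * K)"
  proof -
    have "norm h = norm (p - p') / (4 * K)" using K by (simp add: h_def)
    then show ?thesis using K by (simp only: power_divide) (simp add: power2_eq_square)
  qed
  ultimately have "(norm (p - p'))\<^sup>2 / (8 * K) \<le> 2 * \<delta> + (limit_envelope x - ?E x)"
    using K by (simp add: field_simps)
  then show ?thesis using K by (simp add: K_def field_simps)
qed

text \<open>The inequality for the almost optimal paraboloid of curvature \<open>\<kappa> n\<close> passes to the limit together
  with its slope.\<close>

lemma limit_envelope_paraboloid: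
  "\<exists>p. \<forall>y. limit_envelope y \<le> limit_envelope x + inner p (y - x) + \<mu> * (norm (y - x))\<^sup>2"
proof -
  define \<delta> where "\<delta> n = inverse (real (Suc n))" for n
  define \<kappa> where "\<kappa> n = \<mu> + \<delta> n" for n
  have \<delta>: "\<delta> n > 0" "\<delta> n \<le> 1" for n by (auto simp: \<delta>_def inverse_le_1_iff)
  have \<delta>_mono: "\<delta> n \<le> \<delta> k" if "k \<le> n" for k n using that by (simp add: \<delta>_def)
  have \<delta>_lim: "\<delta> \<longlonglongrightarrow> 0" unfolding \<delta>_def by (rule LIMSEQ_inverse_real_of_nat)
  have \<kappa>_lim: "\<kappa> \<longlonglongrightarrow> \<mu>" unfolding \<kappa>_def using tendsto_add[OF tendsto_const \<delta>_lim, of \<mu>] by simp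
  have "filterlim \<kappa> (at_right \<mu>) sequentially"
    using \<kappa>_lim \<delta>(1) less_imp_neq[OF \<delta>(1)]
    by (auto simp: filterlim_at \<kappa>_def intro!: always_eventually)
  then have E_lim: "(\<lambda>n. envelope m (\<kappa> n) y) \<longlonglongrightarrow> limit_envelope y" for y
    by (rule filterlim_compose[OF tendsto_limit_envelope])
  have "\<exists>c p. paraboloid_above m (\<kappa> n) x c p \<and> c < envelope m (\<kappa> n) x + \<delta> n" for n
  proof -
    have "\<mu> \<le> \<kappa> n" using \<delta>(1)[of n] by (simp add: \<kappa>_def)
    from envelope_approx[OF this \<delta>(1)] show ?thesis by blast
  qed
  then obtain c p where above: "\<And>n. paraboloid_above m (\<kappa> n) x (c n) (p n)"
    and c: "\<And>n. c n < envelope m (\<kappa> n) x + \<delta> n"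
    by metis
  define \<eta> where "\<eta> n = 8 * (\<mu> + 1) * (2 * \<delta> n + (limit_envelope x - envelope m (\<kappa> n) x))" for n
  have bound: "(norm (p n - p k))\<^sup>2 \<le> \<eta> k" if "k \<le> n" for k n
    unfolding \<eta>_def
    using \<delta>[of n] \<delta>[of k] \<delta>_mono[OF that] c[of n] c[of k]
    by (intro slope_difference_bound[OF _ _ _ above _ above]) (auto simp: \<kappa>_def)
  have "\<eta> \<longlonglongrightarrow> 8 * (\<mu> + 1) * (2 * 0 + (limit_envelope x - limit_envelope x))"
    unfolding \<eta>_def by (intro tendsto_intros \<delta>_lim E_lim)
  then have \<eta>_lim: "\<eta> \<longlonglongrightarrow> 0" by simp
  have "Cauchy p"
    unfolding Cauchy_altdef2
  proof (intro allI impI)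
    fix e :: real
    assume "e > 0"
    then have "\<forall>\<^sub>F n in sequentially. \<eta> n < e\<^sup>2"
      using \<eta>_lim by (intro order_tendstoD(2)) auto
    then obtain N where "\<eta> N < e\<^sup>2" by (auto simp: eventually_sequentially)
    then have "(norm (p n - p N))\<^sup>2 < e\<^sup>2" if "n \<ge> N" for n using bound[OF that] by simp
    then have "norm (p n - p N) < e" if "n \<ge> N" for n
      using that \<open>e > 0\<close> by (meson less_imp_le power2_less_imp_less)
    then show "\<exists>N. \<forall>n\<ge>N. dist (p n) (p N) < e" by (auto simp: dist_norm)
  qed
  then obtain q where q: "p \<longlonglongrightarrow> q" using Cauchy_convergent_iff convergent_def by metis
  have "limit_envelope y \<le> limit_envelope x + inner q (y - x) + \<mu> * (norm (y - x))\<^sup>2" for y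
  proof (rule LIMSEQ_le[OF E_lim])
    show "(\<lambda>n. envelope m (\<kappa> n) x + \<delta> n + inner (p n) (y - x) + \<kappa> n * (norm (y - x))\<^sup>2)
        \<longlonglongrightarrow> limit_envelope x + inner q (y - x) + \<mu> * (norm (y - x))\<^sup>2"
      using tendsto_add[OF E_lim \<delta>_lim, of x]
      by (intro tendsto_add tendsto_mult tendsto_inner tendsto_const q \<kappa>_lim) simp
    show "\<exists>N. \<forall>n\<ge>N. envelope m (\<kappa> n) y
        \<le> envelope m (\<kappa> n) x + \<delta> n + inner (p n) (y - x) + \<kappa> n * (norm (y - x))\<^sup>2"
      using envelope_le_paraboloid[OF above, of _ y] c by (smt (verit, best))
  qed
  then show ?thesis by blast
qed

end

text \<open>If a convex function had a point \<open>y\<close> below the affine part, then by convexity it would exceed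
  the paraboloid on the opposite side of \<open>x\<close>, close to \<open>x\<close>.\<close>

lemma convex_affine_below_if_paraboloid_above:
  fixes F :: "'a::real_inner \<Rightarrow> real"
  assumes convex: "convex_on UNIV F"
    and above: "paraboloid_above F \<kappa> x (F x) p"
  shows "F x + inner p (y - x) \<le> F y"
proof (rule field_le_epsilon)
  fix e :: real
  assume "e > 0"
  define d where "d = y - x"
  define C where "C = \<bar>\<kappa>\<bar> * (norm d)\<^sup>2"
  have C: "C \<ge> 0" by (simp add: C_def)
  define t where "t = e / (C + 1)"
  have t: "t > 0" using \<open>e > 0\<close> C by (simp add: t_def)
  have "t * C \<le> t * (C + 1)" using t by simp
  also have "\<dots> = e" using C by (simp add: t_def)
  finally have tC: "t * C \<le> e" .
  have "(1 - t / (1 + t)) *\<^sub>R (x - t *\<^sub>R d) + (t / (1 + t)) *\<^sub>R (x + d) = x"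
  proof -
    have "1 - t / (1 + t) = 1 / (1 + t)" "t / (1 + t) = 1 / (1 + t) * t"
      using t by (simp_all add: field_simps)
    then have "(1 - t / (1 + t)) *\<^sub>R (x - t *\<^sub>R d) + (t / (1 + t)) *\<^sub>R (x + d)
        = (1 / (1 + t)) *\<^sub>R ((x - t *\<^sub>R d) + t *\<^sub>R (x + d))"
      by (simp only: scaleR_scaleR[symmetric] scaleR_add_right[symmetric])
    also have "(x - t *\<^sub>R d) + t *\<^sub>R (x + d) = (1 + t) *\<^sub>R x"
      by (simp add: scaleR_add_right scaleR_add_left)
    finally show ?thesis using t by simp
  qed
  then have "F x \<le> (1 - t / (1 + t)) * F (x - t *\<^sub>R d) + (t / (1 + t)) * F (x + d)"
    using convex_onD[OF convex, of "t / (1 + t)" "x - t *\<^sub>R d" "x + d"] t by simp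
  then have "(1 + t) * F x \<le> (1 + t) * ((1 - t / (1 + t)) * F (x - t *\<^sub>R d) + (t / (1 + t)) * F (x + d))"
    using t by (intro mult_left_mono) auto
  also have "\<dots> = F (x - t *\<^sub>R d) + t * F y"
  proof -
    have "(1 + t) * (1 - t / (1 + t)) = 1" "(1 + t) * (t / (1 + t)) = t"
      using t by (simp_all add: field_simps)
    then show ?thesis
      by (simp only: distrib_left[of "1 + t"] mult.assoc[symmetric]) (simp add: d_def)
  qed
  also have "F (x - t *\<^sub>R d) \<le> F x - t * inner p d + \<kappa> * (t\<^sup>2 * (norm d)\<^sup>2)"
    using above[unfolded paraboloid_above_def, rule_format, of "x - t *\<^sub>R d"] t
    by (simp add: power_mult_distrib)
  also have "\<kappa> * (t\<^sup>2 * (norm d)\<^sup>2) \<le> t * (t * C)"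
  proof -
    have "\<kappa> * (t\<^sup>2 * (norm d)\<^sup>2) \<le> \<bar>\<kappa>\<bar> * (t\<^sup>2 * (norm d)\<^sup>2)" by (intro mult_right_mono) auto
    then show ?thesis by (simp add: C_def power2_eq_square mult_ac)
  qed
  also have "t * (t * C) \<le> t * e" using tC t by (intro mult_left_mono) auto
  finally have "t * (F x + inner p d) \<le> t * (F y + e)" by (simp add: algebra_simps)
  then show "F x + inner p (y - x) \<le> F y + e" using t by (simp add: d_def)
qed

section \<open>Jets with bounded difference quotients\<close>

lemma K1_bound:
  assumes "K1 S \<alpha> v < \<infinity>" and "s \<in> S" "t \<in> S"
  shows "\<bar>\<alpha> t - \<alpha> s - inner (v s) (t - s)\<bar> \<le> enn2real (K1 S \<alpha> v) * (norm (s - t))\<^sup>2"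
proof (cases "s = t")
  case False
  then have "(s, t) \<in> distinct_pairs S" using assms by (simp add: distinct_pairs_def)
  then have "ennreal (\<bar>\<alpha> t - \<alpha> s - inner (v s) (t - s)\<bar> / (norm (s - t))\<^sup>2) \<le> K1 S \<alpha> v"
    unfolding K1_def by (rule SUP_upper2) simp
  also have "\<dots> = ennreal (enn2real (K1 S \<alpha> v))" using assms(1) by simp
  finally show ?thesis using False by (simp add: ennreal_le_iff divide_le_eq)
qed simp

lemma K2_bound:
  assumes "K2 S v < \<infinity>" and "s \<in> S" "t \<in> S"
  shows "norm (v s - v t) \<le> enn2real (K2 S v) * norm (s - t)"
proof (cases "s = t")
  case False
  then have "(s, t) \<in> distinct_pairs S" using assms by (simp add: distinct_pairs_def)
  then have "ennreal (norm (v s - v t) / norm (s - t)) \<le> K2 S v"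
    unfolding K2_def by (rule SUP_upper2) simp
  also have "\<dots> = ennreal (enn2real (K2 S v))" using assms(1) by simp
  finally show ?thesis using False by (simp add: ennreal_le_iff divide_le_eq)
qed simp

lemma mu_bar_nonneg: "mu_bar S \<alpha> v \<ge> 0"
  unfolding mu_bar_def Let_def by (simp add: enn2real_nonneg)

text \<open>The constant \<^const>\<open>mu_bar\<close> is the larger root of this quadratic equation, which says that the
  quadratic form \<open>\<mu> * b\<^sup>2 - (k2 + \<mu>) * a * b + (\<mu> / 2 - k1) * a\<^sup>2\<close> has discriminant zero.\<close>

lemma mu_bar_quadratic:
  fixes S :: "'a::real_inner set" and \<alpha> :: "'a \<Rightarrow> real" and v :: "'a \<Rightarrow> 'a"
  defines "k1 \<equiv> enn2real (K1 S \<alpha> v)" and "k2 \<equiv> enn2real (K2 S v)" and "\<mu> \<equiv> mu_bar S \<alpha> v"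
  shows "(k2 + \<mu>)\<^sup>2 = 4 * \<mu> * (\<mu> / 2 - k1)"
proof -
  have "(\<mu> - (2 * k1 + k2))\<^sup>2 = (2 * k1 + k2)\<^sup>2 + k2\<^sup>2"
    by (simp add: \<mu>_def mu_bar_def Let_def k1_def k2_def)
  then show ?thesis by (simp add: power2_eq_square algebra_simps)
qed

lemma mu_bar_eq_0D:
  assumes "mu_bar S \<alpha> v = 0"
  shows "enn2real (K1 S \<alpha> v) = 0" and "enn2real (K2 S v) = 0"
proof -
  have "enn2real (K1 S \<alpha> v) \<ge> 0" "enn2real (K2 S v) \<ge> 0" by (auto simp: enn2real_nonneg)
  moreover have "sqrt ((2 * enn2real (K1 S \<alpha> v) + enn2real (K2 S v))\<^sup>2 + (enn2real (K2 S v))\<^sup>2) \<ge> 0"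
    by simp
  moreover have "2 * enn2real (K1 S \<alpha> v) + enn2real (K2 S v)
      + sqrt ((2 * enn2real (K1 S \<alpha> v) + enn2real (K2 S v))\<^sup>2 + (enn2real (K2 S v))\<^sup>2) = 0"
    using assms by (simp add: mu_bar_def Let_def)
  ultimately show "enn2real (K1 S \<alpha> v) = 0" and "enn2real (K2 S v) = 0" by linarith+
qed

lemma mu_bar_form_nonneg:
  fixes S :: "'a::real_inner set" and \<alpha> :: "'a \<Rightarrow> real" and v :: "'a \<Rightarrow> 'a"
  defines "k1 \<equiv> enn2real (K1 S \<alpha> v)" and "k2 \<equiv> enn2real (K2 S v)" and "\<mu> \<equiv> mu_bar S \<alpha> v"
  shows "(k2 + \<mu>) * a * b \<le> \<mu> * b\<^sup>2 + (\<mu> / 2 - k1) * a\<^sup>2"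
proof (cases "\<mu> = 0")
  case True
  then show ?thesis using mu_bar_eq_0D[of S \<alpha> v] by (simp add: \<mu>_def k1_def k2_def)
next
  case False
  then have \<mu>: "\<mu> > 0" using mu_bar_nonneg[of S \<alpha> v] by (simp add: \<mu>_def)
  have "(k2 + \<mu>)\<^sup>2 = 4 * \<mu> * (\<mu> / 2 - k1)"
    unfolding k1_def k2_def \<mu>_def by (rule mu_bar_quadratic)
  then have "4 * \<mu> * (\<mu> * b\<^sup>2 + (\<mu> / 2 - k1) * a\<^sup>2 - (k2 + \<mu>) * a * b)
      = 4 * \<mu>\<^sup>2 * b\<^sup>2 - 4 * \<mu> * (k2 + \<mu>) * a * b + (k2 + \<mu>)\<^sup>2 * a\<^sup>2"
    by (simp only:) (simp add: power2_eq_square algebra_simps)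
  also have "\<dots> = (2 * \<mu> * b - (k2 + \<mu>) * a)\<^sup>2"
    by (simp add: power2_eq_square algebra_simps)
  finally have "0 \<le> 4 * \<mu> * (\<mu> * b\<^sup>2 + (\<mu> / 2 - k1) * a\<^sup>2 - (k2 + \<mu>) * a * b)" by simp
  then show ?thesis using \<mu> by (simp add: zero_le_mult_iff)
qed

text \<open>With \<open>d = s - t\<close> and \<open>w = y - t\<close>, the tilt contributes \<open>\<mu> / 2 * |d|\<^sup>2\<close> to the difference of the
  two sides, and what remains to be compared is bounded by the quadratic form above, evaluated at
  \<open>|d|\<close> and \<open>|w|\<close>. The value of \<^const>\<open>mu_bar\<close> is chosen for this inequality.\<close>

lemma tilted_jet_affine_below_paraboloid:
  assumes fin: "K1 S \<alpha> v < \<infinity>" "K2 S v < \<infinity>" and S: "s \<in> S" "t \<in> S"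
  shows "alpha_tilde S \<alpha> v s + inner (v_tilde S \<alpha> v s) (y - s)
    \<le> alpha_tilde S \<alpha> v t + inner (v_tilde S \<alpha> v t) (y - t) + mu_bar S \<alpha> v * (norm (y - t))\<^sup>2"
proof -
  define k1 where "k1 = enn2real (K1 S \<alpha> v)"
  define k2 where "k2 = enn2real (K2 S v)"
  define \<mu> where "\<mu> = mu_bar S \<alpha> v"
  define d where "d = s - t"
  define w where "w = y - t"
  define e where "e = v s - v t"
  have \<mu>: "\<mu> \<ge> 0" unfolding \<mu>_def by (rule mu_bar_nonneg)
  have s: "s = t + d" and y: "y = t + w" and vs: "v s = v t + e"
    by (simp_all add: d_def w_def e_def)
  have "inner (e + \<mu> *\<^sub>R d) w \<le> norm (e + \<mu> *\<^sub>R d) * norm w"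
    by (rule norm_cauchy_schwarz)
  also have "\<dots> \<le> (norm e + norm (\<mu> *\<^sub>R d)) * norm w"
    by (intro mult_right_mono norm_triangle_ineq) simp
  also have "\<dots> \<le> (k2 * norm d + \<mu> * norm d) * norm w"
    using K2_bound[OF fin(2) S] \<mu> by (intro mult_right_mono) (auto simp: d_def e_def k2_def)
  also have "\<dots> = (k2 + \<mu>) * norm d * norm w" by (simp add: algebra_simps)
  also have "\<dots> \<le> \<mu> * (norm w)\<^sup>2 + (\<mu> / 2 - k1) * (norm d)\<^sup>2"
    unfolding k1_def k2_def \<mu>_def by (rule mu_bar_form_nonneg)
  finally have "inner (e + \<mu> *\<^sub>R d) w \<le> \<mu> * (norm w)\<^sup>2 + (\<mu> / 2 - k1) * (norm d)\<^sup>2" .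
  moreover have "- (k1 * (norm d)\<^sup>2) \<le> \<alpha> t - \<alpha> s + inner (v t + e) d"
    using K1_bound[OF fin(1) S] unfolding vs[symmetric] k1_def d_def
    by (simp add: abs_le_iff inner_diff_right)
  moreover have "alpha_tilde S \<alpha> v s + inner (v_tilde S \<alpha> v s) (y - s)
      = \<alpha> s + \<mu> / 2 * (norm t)\<^sup>2 - \<mu> / 2 * (norm d)\<^sup>2 + inner (v t) w + inner e w - inner (v t + e) d
        + \<mu> * inner t w + \<mu> * inner d w"
    unfolding alpha_tilde_def v_tilde_def \<mu>_def[symmetric] vs unfolding s y
    by (simp add: power2_norm_eq_inner inner_simps inner_commute[of d t] algebra_simps)
  moreover have "alpha_tilde S \<alpha> v t + inner (v_tilde S \<alpha> v t) (y - t)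
      = \<alpha> t + \<mu> / 2 * (norm t)\<^sup>2 + inner (v t) w + \<mu> * inner t w"
    unfolding alpha_tilde_def v_tilde_def \<mu>_def[symmetric] y
    by (simp add: inner_simps)
  ultimately show ?thesis
    unfolding \<mu>_def[symmetric] w_def[symmetric]
    by (simp add: inner_simps algebra_simps)
qed

definition affine_sup ::
  "'a::real_inner set \<Rightarrow> ('a \<Rightarrow> real) \<Rightarrow> ('a \<Rightarrow> 'a) \<Rightarrow> 'a \<Rightarrow> real" where
  "affine_sup S a w y = (SUP s\<in>S. a s + inner (w s) (y - s))"

lemma convex_on_affine_sup:
  assumes "S \<noteq> {}" and bdd: "\<And>y. bdd_above ((\<lambda>s. a s + inner (w s) (y - s)) ` S)"
  shows "convex_on UNIV (affine_sup S a w)"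
proof (rule convex_onI)
  fix t :: real and x y :: 'a
  assume t: "0 < t" "t < 1"
  show "affine_sup S a w ((1 - t) *\<^sub>R x + t *\<^sub>R y)
      \<le> (1 - t) * affine_sup S a w x + t * affine_sup S a w y"
    unfolding affine_sup_def[of S a w "(1 - t) *\<^sub>R x + t *\<^sub>R y"]
  proof (rule cSUP_least)
    fix s
    assume "s \<in> S"
    have le: "a s + inner (w s) (z - s) \<le> affine_sup S a w z" for z
      unfolding affine_sup_def using \<open>s \<in> S\<close> bdd by (rule cSUP_upper)
    have "a s + inner (w s) ((1 - t) *\<^sub>R x + t *\<^sub>R y - s)
        = (1 - t) * (a s + inner (w s) (x - s)) + t * (a s + inner (w s) (y - s))"
      by (simp add: inner_simps algebra_simps)
    also have "\<dots> \<le> (1 - t) * affine_sup S a w x + t * affine_sup S a w y"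
      using t le by (intro add_mono mult_left_mono) auto
    finally show "a s + inner (w s) ((1 - t) *\<^sub>R x + t *\<^sub>R y - s)
        \<le> (1 - t) * affine_sup S a w x + t * affine_sup S a w y" .
  qed fact
qed simp

text \<open>In terms of the curvature \<open>1 / (2 * \<epsilon>)\<close>, both cases of \<^const>\<open>eps_filter\<close> are the same limit
  from the right.\<close>

lemma filterlim_curvature:
  assumes "\<mu> \<ge> 0"
  shows "filterlim (\<lambda>\<epsilon>. 1 / (2 * \<epsilon>)) (at_right \<mu>) (eps_filter \<mu>)"
proof (cases "\<mu> = 0")
  case True
  have "filterlim (\<lambda>\<epsilon>::real. inverse (2 * \<epsilon>)) (at_right 0) at_top"
    by (intro filterlim_compose[OF filterlim_inverse_at_right_top]
        filterlim_tendsto_pos_mult_at_top[OF tendsto_const] filterlim_ident) simp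
  then show ?thesis using True by (simp add: eps_filter_def inverse_eq_divide)
next
  case False
  then have \<mu>: "\<mu> > 0" using assms by simp
  have "((\<lambda>\<epsilon>. 1 / (2 * \<epsilon>)) \<longlongrightarrow> 1 / (2 * (1 / (2 * \<mu>)))) (at_left (1 / (2 * \<mu>)))"
    using \<mu> by (intro tendsto_intros) auto
  then have "((\<lambda>\<epsilon>. 1 / (2 * \<epsilon>)) \<longlongrightarrow> \<mu>) (at_left (1 / (2 * \<mu>)))" using \<mu> by simp
  moreover have "\<forall>\<^sub>F \<epsilon> in at_left (1 / (2 * \<mu>)). \<epsilon> \<in> {0<..<1 / (2 * \<mu>)}"
    using \<mu> by (intro eventually_at_left_real) simp
  then have "\<forall>\<^sub>F \<epsilon> in at_left (1 / (2 * \<mu>)). 1 / (2 * \<epsilon>) \<in> {\<mu><..} \<and> 1 / (2 * \<epsilon>) \<noteq> \<mu>"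
    by eventually_elim (use \<mu> in \<open>auto simp: field_simps\<close>)
  ultimately show ?thesis using False by (simp add: eps_filter_def filterlim_at)
qed

lemma eps_filter_nontrivial: "eps_filter \<mu> \<noteq> bot"
  by (simp add: eps_filter_def trivial_limit_at_left_real)

text \<open>Each term of \<^const>\<open>Gamma1\<close> bounds \<open>|A| + |B|\<close>, and the quotients in \<^const>\<open>K1\<close> and \<^const>\<open>K2\<close>
  are at most \<open>(|A| + |B|) / 2\<close> and \<open>|B|\<close>. This yields the factor \<open>2 + sqrt 5\<close>.\<close>

lemma mu_bar_le_Gamma1:
  "ennreal (mu_bar S \<alpha> v) \<le> ennreal (2 + sqrt 5) * Gamma1 S \<alpha> v"
proof (cases "Gamma1 S \<alpha> v")
  case (real r)
  have AB: "norm (coefB v s t) + \<bar>coefA \<alpha> v s t\<bar> \<le> r" if "s \<in> S" "t \<in> S" "s \<noteq> t" for s t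
  proof -
    have "Gamma1 S \<alpha> v \<le> ennreal r" using real by simp
    from order_trans[OF norm_coefB_le_Gamma1_term Gamma1_term_le[OF this real(1) that]]
    show ?thesis .
  qed
  have "K2 S v \<le> ennreal r"
    unfolding K2_def distinct_pairs_def
  proof (intro SUP_least, clarify)
    fix s t
    assume "s \<in> S" "t \<in> S" "s \<noteq> t"
    from AB[OF this] have "norm (coefB v s t) \<le> r" by simp
    then show "ennreal (norm (v s - v t) / norm (s - t)) \<le> ennreal r"
      by (intro ennreal_leI) (simp add: norm_coefB)
  qed
  then have k2: "enn2real (K2 S v) \<le> r" using real(1) by (rule enn2real_leI[rotated])
  have "K1 S \<alpha> v \<le> ennreal (r / 2)"
    unfolding K1_def distinct_pairs_def
  proof (intro SUP_least, clarify)
    fix s t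
    assume st: "s \<in> S" "t \<in> S" "s \<noteq> t"
    define n where "n = norm (s - t)"
    have n: "n > 0" using st by (simp add: n_def)
    have "coefA \<alpha> v s t * n\<^sup>2 = 2 * (\<alpha> s - \<alpha> t) + inner (v s + v t) (t - s)"
      using n by (simp add: coefA_def n_def)
    then have "2 * (\<alpha> t - \<alpha> s - inner (v s) (t - s))
        = - coefA \<alpha> v s t * n\<^sup>2 + inner (v t - v s) (t - s)"
      by (simp add: inner_simps)
    then have "2 * \<bar>\<alpha> t - \<alpha> s - inner (v s) (t - s)\<bar>
        \<le> \<bar>coefA \<alpha> v s t * n\<^sup>2\<bar> + \<bar>inner (v t - v s) (t - s)\<bar>"
      by linarith
    also have "\<bar>coefA \<alpha> v s t * n\<^sup>2\<bar> = \<bar>coefA \<alpha> v s t\<bar> * n\<^sup>2"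
      by (simp add: abs_mult)
    also have "\<bar>inner (v t - v s) (t - s)\<bar> \<le> norm (v t - v s) * norm (t - s)"
      by (rule Cauchy_Schwarz_ineq2)
    also have "\<dots> = norm (coefB v s t) * n\<^sup>2"
      using n by (simp add: norm_coefB n_def norm_minus_commute power2_eq_square)
    also have "\<bar>coefA \<alpha> v s t\<bar> * n\<^sup>2 + norm (coefB v s t) * n\<^sup>2 \<le> r * n\<^sup>2"
      using mult_right_mono[OF AB[OF st], of "n\<^sup>2"] by (simp add: algebra_simps)
    finally have "\<bar>\<alpha> t - \<alpha> s - inner (v s) (t - s)\<bar> / n\<^sup>2 \<le> r / 2"
      using n by (simp add: field_simps)
    then show "ennreal (\<bar>\<alpha> t - \<alpha> s - inner (v s) (t - s)\<bar> / (norm (s - t))\<^sup>2) \<le> ennreal (r / 2)"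
      unfolding n_def by (rule ennreal_leI)
  qed
  then have k1: "enn2real (K1 S \<alpha> v) \<le> r / 2" using real(1) by (intro enn2real_leI) simp_all
  have nonneg: "enn2real (K1 S \<alpha> v) \<ge> 0" "enn2real (K2 S v) \<ge> 0" by (auto simp: enn2real_nonneg)
  have "(2 * enn2real (K1 S \<alpha> v) + enn2real (K2 S v))\<^sup>2 + (enn2real (K2 S v))\<^sup>2 \<le> (2 * r)\<^sup>2 + r\<^sup>2"
    using k1 k2 nonneg by (intro add_mono power_mono) auto
  also have "\<dots> = 5 * r\<^sup>2" by (simp add: power_mult_distrib)
  finally have "sqrt ((2 * enn2real (K1 S \<alpha> v) + enn2real (K2 S v))\<^sup>2 + (enn2real (K2 S v))\<^sup>2) \<le> sqrt (5 * r\<^sup>2)"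
    by (rule real_sqrt_le_mono)
  also have "\<dots> = sqrt 5 * r" using real(1) by (simp add: real_sqrt_mult)
  finally have "mu_bar S \<alpha> v \<le> (2 + sqrt 5) * r"
    using k1 k2 by (simp add: mu_bar_def Let_def algebra_simps)
  then show ?thesis
    unfolding real(2) using real(1) by (simp add: ennreal_leI del: ennreal_plus flip: ennreal_mult)
next
  case top
  have "2 + sqrt 5 > 0" by (simp add: add_pos_nonneg)
  then show ?thesis by (simp add: top ennreal_mult_top)
qed

section \<open>The extension\<close>

theorem theorem3p1:
  fixes S :: "'a::{real_inner, complete_space} set"
    and \<alpha> :: "'a \<Rightarrow> real" and v :: "'a \<Rightarrow> 'a"
  assumes "S \<noteq> {}"
    and "K1 S \<alpha> v < \<infinity>"
    and "K2 S v < \<infinity>"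
  shows "(\<forall>x. ((\<lambda>\<epsilon>. F_eps S \<alpha> v \<epsilon> x) \<longlongrightarrow> ereal (F_ext S \<alpha> v x)) (eps_filter (mu_bar S \<alpha> v))) \<and>
    convex_on UNIV (F_ext S \<alpha> v) \<and>
    C11_extension S (alpha_tilde S \<alpha> v) (v_tilde S \<alpha> v) (F_ext S \<alpha> v) \<and>
    C11_extension S \<alpha> v (G_ext S \<alpha> v) \<and>
    Gamma1 S \<alpha> v \<le> Gamma1 UNIV (G_ext S \<alpha> v) (grad (G_ext S \<alpha> v)) \<and>
    Gamma1 UNIV (G_ext S \<alpha> v) (grad (G_ext S \<alpha> v)) = Lip (grad (G_ext S \<alpha> v)) \<and>
    Lip (grad (G_ext S \<alpha> v)) \<le> ennreal ((5 + sqrt 29) / 2) * Gamma1 S \<alpha> v"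
proof -
  define \<mu> where "\<mu> = mu_bar S \<alpha> v"
  define a where "a = alpha_tilde S \<alpha> v"
  define w where "w = v_tilde S \<alpha> v"
  define m where "m = affine_sup S a w"
  define F where "F = F_ext S \<alpha> v"
  define G where "G = G_ext S \<alpha> v"
  have \<mu>: "\<mu> \<ge> 0" unfolding \<mu>_def by (rule mu_bar_nonneg)
  have below: "a s + inner (w s) (y - s) \<le> a t + inner (w t) (y - t) + \<mu> * (norm (y - t))\<^sup>2"
    if "s \<in> S" "t \<in> S" for s t y
    using tilted_jet_affine_below_paraboloid[OF assms(2,3) that] unfolding a_def w_def \<mu>_def .
  obtain t0 where t0: "t0 \<in> S" using \<open>S \<noteq> {}\<close> by blast
  have bdd: "bdd_above ((\<lambda>s. a s + inner (w s) (y - s)) ` S)" for y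
    by (rule bdd_aboveI2) (rule below[OF _ t0])
  have m_ge: "a s + inner (w s) (y - s) \<le> m y" if "s \<in> S" for s y
    unfolding m_def affine_sup_def using that bdd by (rule cSUP_upper)
  have m_above: "paraboloid_above m \<mu> t (a t) (w t)" if "t \<in> S" for t
    unfolding paraboloid_above_def m_def affine_sup_def
    using below[OF _ that] \<open>S \<noteq> {}\<close> by (intro allI cSUP_least) auto
  have f_tilde: "f_tilde S \<alpha> v y = ereal (m y)" for y
  proof -
    have "(SUP s\<in>S. ereal (a s + inner (w s) (y - s))) \<le> ereal (m y)"
      using m_ge by (intro SUP_least) simp
    moreover have "ereal (a t0 + inner (w t0) (y - t0)) \<le> (SUP s\<in>S. ereal (a s + inner (w s) (y - s)))"
      using t0 by (rule SUP_upper)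
    ultimately have "\<bar>SUP s\<in>S. ereal (a s + inner (w s) (y - s))\<bar> \<noteq> \<infinity>"
      by (cases "SUP s\<in>S. ereal (a s + inner (w s) (y - s))") auto
    from ereal_SUP[OF this] show ?thesis
      by (simp add: f_tilde_def m_def affine_sup_def a_def w_def)
  qed
  interpret convex_below_paraboloid m \<mu>
  proof
    show "convex_on UNIV m" unfolding m_def using \<open>S \<noteq> {}\<close> bdd by (rule convex_on_affine_sup)
    show "\<exists>x c p. paraboloid_above m \<mu> x c p" using m_above[OF t0] by blast
  qed (rule \<mu>)

  have curvature: "filterlim (\<lambda>\<epsilon>. 1 / (2 * \<epsilon>)) (at_right \<mu>) (eps_filter \<mu>)"
    by (rule filterlim_curvature[OF \<mu>])
  have lim: "((\<lambda>\<epsilon>. F_eps S \<alpha> v \<epsilon> x) \<longlongrightarrow> ereal (limit_envelope x)) (eps_filter \<mu>)" for x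
  proof (rule Lim_transform_eventually)
    show "((\<lambda>\<epsilon>. ereal (envelope m (1 / (2 * \<epsilon>)) x)) \<longlongrightarrow> ereal (limit_envelope x)) (eps_filter \<mu>)"
      by (intro tendsto_intros filterlim_compose[OF tendsto_limit_envelope curvature])
    have "\<forall>\<^sub>F \<epsilon> in eps_filter \<mu>. 1 / (2 * \<epsilon>) > \<mu>"
      using curvature by (auto simp: filterlim_at elim: eventually_mono)
    then show "\<forall>\<^sub>F \<epsilon> in eps_filter \<mu>. ereal (envelope m (1 / (2 * \<epsilon>)) x) = F_eps S \<alpha> v \<epsilon> x"
    proof eventually_elim
      case (elim \<epsilon>)
      then have "1 / (2 * \<epsilon>) > 0" using \<mu> by linarith
      from INF_SUP_eq_envelope[OF this ex_paraboloid_above] elim show ?case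
        by (simp add: F_eps_def f_tilde)
    qed
  qed
  have F: "F = limit_envelope"
    using tendsto_Lim[OF eps_filter_nontrivial lim] by (simp add: F_def F_ext_def \<mu>_def fun_eq_iff)
  have convF: "convex_on UNIV F" unfolding F by (rule convex_on_limit_envelope)

  have "\<forall>x. \<exists>p. paraboloid_above F \<mu> x (F x) p"
    unfolding F paraboloid_above_def using limit_envelope_paraboloid by blast
  then obtain g where g: "\<And>x. paraboloid_above F \<mu> x (F x) (g x)" by metis
  have F_upper: "F y \<le> F x + inner (g x) (y - x) + \<mu> * (norm (y - x))\<^sup>2" for x y
    using g[of x] by (simp add: paraboloid_above_def)
  have F_lower: "F x + inner (g x) (y - x) \<le> F y" for x y
    by (rule convex_affine_below_if_paraboloid_above[OF convF g])
  have "\<bar>F y - F x - inner (g x) (y - x)\<bar> \<le> \<mu> * (norm (y - x))\<^sup>2" for x y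
    using F_upper[of y x] F_lower[of x y] by (simp add: abs_le_iff)
  then have taylorF: "taylor_bound (2 * \<mu>) F g"
    by (simp add: taylor_bound_def)
  have gradF: "grad F = g"
    using grad_eqI[OF taylor_bound_GDERIV[OF taylorF]] by (simp add: fun_eq_iff)

  have F_S: "F s = a s" and g_S: "g s = w s" if s: "s \<in> S" for s
  proof -
    have upper: "F y \<le> a s + inner (w s) (y - s) + \<mu> * (norm (y - s))\<^sup>2" for y
      unfolding F by (rule limit_envelope_le_paraboloid[OF m_above[OF s]])
    have lower: "a s + inner (w s) (y - s) \<le> F y" for y
      unfolding F by (rule order_trans[OF m_ge[OF s] le_limit_envelope])
    show Fs: "F s = a s" using upper[of s] lower[of s] by simp
    have "GDERIV F s :> w s"
      using upper lower
      by (intro GDERIV_if_quadratic_error[where C = \<mu>]) (simp add: Fs abs_le_iff algebra_simps)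
    then show "g s = w s"
      by (rule GDERIV_unique[OF taylor_bound_GDERIV[OF taylorF]])
  qed
  have extF: "C11_extension S a w F"
    unfolding C11_extension_def gradF
    using taylor_bound_GDERIV[OF taylorF] taylor_bound_lipschitz[OF taylorF] \<mu> F_S g_S by auto

  \<comment> \<open>Subtracting half of the allowed curvature turns the one-sided bounds \<open>0\<close> and \<open>\<mu>\<close> into the
    symmetric bounds \<open>- \<mu> / 2\<close> and \<open>\<mu> / 2\<close>, which halves the Lipschitz constant.\<close>
  define k where "k x = g x - \<mu> *\<^sub>R x" for x
  have G: "G x = F x - \<mu> / 2 * (norm x)\<^sup>2" for x
    by (simp add: G_def G_ext_def F_def \<mu>_def)
  have taylorG: "taylor_bound \<mu> G k"
    unfolding taylor_bound_def
  proof (intro allI)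
    fix x y :: 'a
    define d where "d = y - x"
    have y: "y = x + d" by (simp add: d_def)
    have "G y - G x - inner (k x) (y - x) = F y - F x - inner (g x) (y - x) - \<mu> / 2 * (norm (y - x))\<^sup>2"
      unfolding G k_def d_def[symmetric] unfolding y
      by (simp add: power2_norm_eq_inner inner_simps inner_commute[of d x] algebra_simps)
    then show "\<bar>G y - G x - inner (k x) (y - x)\<bar> \<le> \<mu> / 2 * (norm (y - x))\<^sup>2"
      using F_upper[of y x] F_lower[of x y] by (simp only: abs_le_iff) linarith
  qed
  have derivG: "GDERIV G x :> k x" for x by (rule taylor_bound_GDERIV[OF taylorG])
  have gradG: "grad G = k" using grad_eqI[OF derivG] by (simp add: fun_eq_iff)
  have lipG: "\<mu>-lipschitz_on UNIV k" by (rule taylor_bound_lipschitz[OF taylorG \<mu>])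
  have G_S: "G s = \<alpha> s" "k s = v s" if "s \<in> S" for s
    using F_S[OF that] g_S[OF that]
    by (simp_all add: G k_def a_def w_def alpha_tilde_def v_tilde_def \<mu>_def)
  have extG: "C11_extension S \<alpha> v G"
    unfolding C11_extension_def gradG using derivG lipG G_S by auto

  have "Gamma1 S \<alpha> v = Gamma1 S G k"
    unfolding Gamma1_def
    by (rule SUP_cong) (auto simp: distinct_pairs_def coefA_def coefB_def G_S)
  also have "\<dots> \<le> Gamma1 UNIV G k"
    unfolding Gamma1_def by (rule SUP_subset_mono) (auto simp: distinct_pairs_def)
  finally have Gamma1_le: "Gamma1 S \<alpha> v \<le> Gamma1 UNIV G k" .

  have "Lip k \<le> ennreal \<mu>" unfolding Lip_def using lipG by (intro INF_lower) simp
  also have "\<dots> \<le> ennreal (2 + sqrt 5) * Gamma1 S \<alpha> v"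
    unfolding \<mu>_def by (rule mu_bar_le_Gamma1)
  also have "\<dots> \<le> ennreal ((5 + sqrt 29) / 2) * Gamma1 S \<alpha> v"
  proof (intro mult_right_mono ennreal_leI)
    have "2 * sqrt 5 = sqrt 20" by (simp add: real_sqrt_mult[of 4 5, simplified])
    also have "\<dots> \<le> sqrt 29" by simp
    finally show "2 + sqrt 5 \<le> (5 + sqrt 29) / 2" by simp
  qed simp
  finally have Lip_le: "Lip k \<le> ennreal ((5 + sqrt 29) / 2) * Gamma1 S \<alpha> v" .

  show ?thesis
    using lim convF extF extG Gamma1_le Lip_le Gamma1_UNIV_eq_Lip[of G k, OF derivG]
    unfolding F[symmetric] F_def[symmetric] G_def[symmetric] gradG \<mu>_def[symmetric]
      a_def[symmetric] w_def[symmetric]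
    by blast
qed

end
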